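(* Let $(\Omega,\mathcal H,\hat{\mathbb E})$ be a sublinear expectation space, let $0<\underline\sigma^2<\overline\sigma^2$, and let $$\Gamma=\left\{\begin{bmatrix} r_1&0\\0&r_2\end{bmatrix} : r_1,r_2\in[\underline\sigma^2,\overline\sigma^2]\right\}.$$ Let $X\in\mathcal H^2$ be a random vector with $X\sim\mathcal N(0,\Gamma)$. Then there is no invertible $2\times2$ real matrix $A$ such that the coordinates of $AX$ are independent; that is, there is no invertible real $2\times 2$ matrix $A$ such that, writing $(W_1,W_2)^\top=AX$, either $W_2$ is independent from $W_1$ or $W_1$ is independent from $W_2$.
   Context: $C_{l.Lip}(\mathbb R^n)$ is the set of functions $\varphi:\mathbb R^n\to\mathbb R$ for which there exist $C>0$ and $m\in\mathbb N$ with $|\varphi(x)-\varphi(y)|\le C(1+|x|^m+|y|^m)|x-y|$ for all $x,y\in\mathbb R^n$. Let $\Omega$ be a set and $\mathcal H$ a linear space of real-valued functions on $\Omega$ which contains all constants and contains $\varphi(X_1,\dots,X_n)$ whenever $X_1,\dots,X_n\in\mathcal H$ and $\varphi\in C_{l.Lip}(\mathbb R^n)$. A sublinear expectation is a map $\hat{\mathbb E}:\mathcal H\to\mathbb R$ such that: $\hat{\mathbb E}[X]\le\hat{\mathbb E}[Y]$ if $X\le Y$; $\hat{\mathbb E}[c]=c$ for $c\in\mathbb R$; $\hat{\mathbb E}[X+Y]\le\hat{\mathbb E}[X]+\hat{\mathbb E}[Y]$; $\hat{\mathbb E}[\lambda X]=\lambda\hat{\mathbb E}[X]$ for $\lambda\ge0$.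 Then $(\Omega,\mathcal H,\hat{\mathbb E})$ is a sublinear expectation space. Elements of $\mathcal H$ are random variables; elements of $\mathcal H^n$ are $n$-dimensional random vectors. Independence (possibly asymmetric): $Y\in\mathcal H^n$ is independent from $X\in\mathcal H^m$ if $\hat{\mathbb E}[\varphi(X,Y)]=\hat{\mathbb E}\big[\hat{\mathbb E}[\varphi(x,Y)]_{x=X}\big]$ for all $\varphi\in C_{l.Lip}(\mathbb R^{m+n})$. Identical distribution: $X,Y\in\mathcal H^n$ satisfy $X\sim Y$ if $\hat{\mathbb E}[\varphi(X)]=\hat{\mathbb E}[\varphi(Y)]$ for all $\varphi\in C_{l.Lip}(\mathbb R^n)$. If $X\sim\bar X$ and $\bar X$ is independent from $X$, then $\bar X$ is an independent copy of $X$. $G$-normality: $X\in\mathcal H^n$ is $G$-normally distributed (a $G$-normal random vector) if $aX+b\bar X\sim\sqrt{a^2+b^2}\,X$ for all $a,b\ge0$ and any independent copy $\bar X$ of $X$. As usual the independent copy may live on an enlarged (product) sublinear expectation space, so the condition is never vacuous; it means exactly that $\hat{\mathbb E}\big[\hat{\mathbb E}[\varphi(ax+bX)]_{x=X}\big]=\hat{\mathbb E}[\varphi(\sqrt{a^2+b^2}\,X)]$ for all $a,b\ge0$ and $\varphi\in C_{l.Lip}(\mathbb R^n)$. For a bounded, closed, convex subset $\Gamma$ of the positive semidefinite symmetric $n\times n$ matrices, $X\sim\mathcal N(0,\Gamma)$ means that $X$ is an $n$-dimensional $G$-normal random vector with $\frac12\hat{\mathbb E}[\langle AX,X\rangle]=\frac12\sup_{B\in\Gamma}\mathrm{tr}[AB]$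 for all symmetric $n\times n$ matrices $A$. ($\Gamma$ is uniquely determined by $X$, and determines the distribution of $X$.) *)

theory Defs
  imports "HOL-Analysis.Analysis"
begin

section \<open>Locally Lipschitz functions of polynomial growth\<close>

text \<open>
  The space is available on every Euclidean space \<open>'a\<close>. The norm of a product type is the
  Euclidean one, so \<open>'a \<times> 'b\<close> plays the role of \<open>\<real>\<^sup>m\<^sup>+\<^sup>n\<close>, and \<open>real\<close> that of \<open>\<real>\<^sup>1\<close>.
\<close>

definition C_lLip :: "('a::euclidean_space \<Rightarrow> real) set" where
  "C_lLip = {\<phi>. \<exists>C>0. \<exists>m::nat. \<forall>x y.
     \<bar>\<phi> x - \<phi> y\<bar> \<le> C * (1 + norm x ^ m + norm y ^ m) * norm (x - y)}"

text \<open>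
  The closure property of the space of random variables quantifies over all dimensions \<open>n\<close>, which
  cannot be done with types. Here \<open>\<real>\<^sup>n\<close> is encoded by the first \<open>n\<close> entries of a sequence: since
  \<open>L2_set (\<lambda>i. x i - y i) {..<n}\<close> vanishes if \<open>x\<close> and \<open>y\<close> agree below \<open>n\<close>, a member of
  \<open>C_lLip_dim n\<close> depends on the entries below \<open>n\<close> only.
\<close>

definition C_lLip_dim :: "nat \<Rightarrow> ((nat \<Rightarrow> real) \<Rightarrow> real) set" where
  "C_lLip_dim n = {\<phi>. \<exists>C>0. \<exists>m::nat. \<forall>x y.
     \<bar>\<phi> x - \<phi> y\<bar> \<le>
       C * (1 + L2_set x {..<n} ^ m + L2_set y {..<n} ^ m) * L2_set (\<lambda>i. x i - y i) {..<n}}"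

section \<open>Sublinear expectation spaces\<close>

text \<open>
  The sample space is the type \<open>'w\<close>. The functional \<open>E\<close> is a total function, but nothing
  is assumed about its values outside \<open>H\<close>.
\<close>

locale sublinear_expectation_space =
  fixes H :: "('w \<Rightarrow> real) set" and E :: "('w \<Rightarrow> real) \<Rightarrow> real"
  assumes const_mem: "(\<lambda>\<omega>. c) \<in> H"
    and add_mem: "X \<in> H \<Longrightarrow> Y \<in> H \<Longrightarrow> (\<lambda>\<omega>. X \<omega> + Y \<omega>) \<in> H"
    and scale_mem: "X \<in> H \<Longrightarrow> (\<lambda>\<omega>. c * X \<omega>) \<in> H"
    and comp_mem: "(\<And>i. i < n \<Longrightarrow> Z i \<in> H) \<Longrightarrow> \<phi> \<in> C_lLip_dim n \<Longrightarrow> (\<lambda>\<omega>. \<phi> (\<lambda>i. Z i \<omega>)) \<in> H"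
    and E_mono: "X \<in> H \<Longrightarrow> Y \<in> H \<Longrightarrow> (\<And>\<omega>. X \<omega> \<le> Y \<omega>) \<Longrightarrow> E X \<le> E Y"
    and E_const: "E (\<lambda>\<omega>. c) = c"
    and E_subadd: "X \<in> H \<Longrightarrow> Y \<in> H \<Longrightarrow> E (\<lambda>\<omega>. X \<omega> + Y \<omega>) \<le> E X + E Y"
    and E_pos_hom: "X \<in> H \<Longrightarrow> 0 \<le> l \<Longrightarrow> E (\<lambda>\<omega>. l * X \<omega>) = l * E X"

definition random_vector :: "('w \<Rightarrow> real) set \<Rightarrow> ('w \<Rightarrow> 'a::euclidean_space) \<Rightarrow> bool" where
  "random_vector H X \<longleftrightarrow> (\<forall>b\<in>Basis. (\<lambda>\<omega>. X \<omega> \<bullet> b) \<in> H)"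

lemma random_vector_real: "random_vector H (X :: 'w \<Rightarrow> real) \<longleftrightarrow> X \<in> H"
  by (simp add: random_vector_def)

lemma random_vector_cart: "random_vector H (X :: 'w \<Rightarrow> real ^ 'n) \<longleftrightarrow> (\<forall>i. (\<lambda>\<omega>. X \<omega> $ i) \<in> H)"
  by (auto simp: random_vector_def Basis_vec_def inner_axis)

lemma norm_sum_Basis_eq_L2_set:
  fixes b :: "nat \<Rightarrow> 'a::euclidean_space"
  assumes b: "bij_betw b {..<n} Basis"
  shows "norm (\<Sum>i<n. x i *\<^sub>R b i) = L2_set x {..<n}"
proof -
  have inner_b: "b i \<bullet> b j = (if i = j then 1 else 0)" if "i < n" "j < n" for i j
  proof -
    have "b i \<in> Basis" "b j \<in> Basis" "b i = b j \<longleftrightarrow> i = j"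
      using that b by (auto simp: bij_betw_def inj_on_eq_iff)
    then show ?thesis by (simp add: inner_Basis)
  qed
  have "(\<Sum>i<n. x i *\<^sub>R b i) \<bullet> (\<Sum>j<n. x j *\<^sub>R b j) = (\<Sum>i<n. \<Sum>j<n. x i * (x j * (b i \<bullet> b j)))"
    by (simp add: inner_sum_left inner_sum_right sum_distrib_left)
      (subst sum.swap, simp add: mult_ac inner_commute)
  also have "\<dots> = (\<Sum>i<n. \<Sum>j<n. if i = j then x i * x j else 0)"
    by (intro sum.cong refl) (simp add: inner_b)
  also have "\<dots> = (\<Sum>i<n. (x i)\<^sup>2)"
    by (simp add: power2_eq_square)
  finally show ?thesis by (simp add: norm_eq_sqrt_inner L2_set_def)
qed

text \<open>The two renderings of locally Lipschitz functions agree on random vectors.\<close>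

lemma (in sublinear_expectation_space) C_lLip_comp_mem:
  fixes X :: "'w \<Rightarrow> 'a::euclidean_space"
  assumes X: "random_vector H X" and \<phi>: "\<phi> \<in> C_lLip"
  shows "(\<lambda>\<omega>. \<phi> (X \<omega>)) \<in> H"
proof -
  define n where "n = DIM('a)"
  obtain b :: "nat \<Rightarrow> 'a" where b: "bij_betw b {..<n} Basis"
    using ex_bij_betw_nat_finite[OF finite_Basis] by (auto simp: n_def lessThan_atLeast0)
  define \<psi> where "\<psi> x = \<phi> (\<Sum>i<n. x i *\<^sub>R b i)" for x
  obtain C m where "C > 0" and C: "\<And>x y.
      \<bar>\<phi> x - \<phi> y\<bar> \<le> C * (1 + norm x ^ m + norm y ^ m) * norm (x - y)"
    using \<phi> by (auto simp: C_lLip_def)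
  have "\<bar>\<psi> x - \<psi> y\<bar> \<le>
      C * (1 + L2_set x {..<n} ^ m + L2_set y {..<n} ^ m) * L2_set (\<lambda>i. x i - y i) {..<n}" for x y
  proof -
    have "(\<Sum>i<n. x i *\<^sub>R b i) - (\<Sum>i<n. y i *\<^sub>R b i) = (\<Sum>i<n. (x i - y i) *\<^sub>R b i)"
      by (simp add: sum_subtractf scaleR_diff_left)
    then show ?thesis
      using C[of "\<Sum>i<n. x i *\<^sub>R b i" "\<Sum>i<n. y i *\<^sub>R b i"]
      by (simp add: \<psi>_def norm_sum_Basis_eq_L2_set[OF b])
  qed
  then have "\<psi> \<in> C_lLip_dim n"
    using \<open>C > 0\<close> unfolding C_lLip_dim_def by blast
  moreover have "(\<lambda>\<omega>. X \<omega> \<bullet> b i) \<in> H" if "i < n" for i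
    using X b that by (auto simp: random_vector_def bij_betw_def)
  ultimately have "(\<lambda>\<omega>. \<psi> (\<lambda>i. X \<omega> \<bullet> b i)) \<in> H"
    using comp_mem[of n "\<lambda>i \<omega>. X \<omega> \<bullet> b i" \<psi>] by simp
  moreover have "(\<Sum>i<n. (x \<bullet> b i) *\<^sub>R b i) = x" for x
    using sum.reindex_bij_betw[OF b, of "\<lambda>u. (x \<bullet> u) *\<^sub>R u"] by (simp add: euclidean_representation)
  ultimately show ?thesis by (simp add: \<psi>_def)
qed

section \<open>Independence and identical distribution\<close>

text \<open>\<open>independent_from E Y X\<close> reads: \<open>Y\<close> is independent from \<open>X\<close>. The relation is not symmetric.\<close>

definition independent_from ::
    "(('w \<Rightarrow> real) \<Rightarrow> real) \<Rightarrow> ('w \<Rightarrow> 'b::euclidean_space) \<Rightarrow> ('w \<Rightarrow> 'a::euclidean_space) \<Rightarrow> bool" where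
  "independent_from E Y X \<longleftrightarrow> (\<forall>\<phi> \<in> (C_lLip :: ('a \<times> 'b \<Rightarrow> real) set).
     E (\<lambda>\<omega>. \<phi> (X \<omega>, Y \<omega>)) = E (\<lambda>\<omega>. E (\<lambda>\<omega>'. \<phi> (X \<omega>, Y \<omega>'))))"

definition same_distribution ::
    "(('w \<Rightarrow> real) \<Rightarrow> real) \<Rightarrow> ('w \<Rightarrow> 'a::euclidean_space) \<Rightarrow> ('w \<Rightarrow> 'a) \<Rightarrow> bool" where
  "same_distribution E X Y \<longleftrightarrow> (\<forall>\<phi>\<in>C_lLip. E (\<lambda>\<omega>. \<phi> (X \<omega>)) = E (\<lambda>\<omega>. \<phi> (Y \<omega>)))"

definition independent_copy ::
    "(('w \<Rightarrow> real) \<Rightarrow> real) \<Rightarrow> ('w \<Rightarrow> 'a::euclidean_space) \<Rightarrow> ('w \<Rightarrow> 'a) \<Rightarrow> bool" where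
  "independent_copy E X Xbar \<longleftrightarrow> same_distribution E X Xbar \<and> independent_from E Xbar X"

section \<open>G-normal random vectors\<close>

text \<open>
  \<open>X\<close> is G-normal if \<open>a X + b Xbar\<close> and \<open>sqrt (a\<^sup>2 + b\<^sup>2) X\<close> have the same distribution for any
  independent copy \<open>Xbar\<close> of \<open>X\<close>, which may live on a product space. On the product space the law of
  \<open>a X + b Xbar\<close> is given by the iterated expectation below, so that the condition makes sense (and
  is not vacuous) even if the given space carries no independent copy of \<open>X\<close>. Lemma
  \<open>G_normal_iff_independent_copy\<close> confirms the equivalence when there is one.
\<close>

definition G_normal ::
    "('w \<Rightarrow> real) set \<Rightarrow> (('w \<Rightarrow> real) \<Rightarrow> real) \<Rightarrow> ('w \<Rightarrow> 'a::euclidean_space) \<Rightarrow> bool" where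
  "G_normal H E X \<longleftrightarrow> random_vector H X \<and>
     (\<forall>a\<ge>0. \<forall>b\<ge>0. \<forall>\<phi>\<in>C_lLip.
        E (\<lambda>\<omega>. E (\<lambda>\<omega>'. \<phi> (a *\<^sub>R X \<omega> + b *\<^sub>R X \<omega>'))) = E (\<lambda>\<omega>. \<phi> (sqrt (a\<^sup>2 + b\<^sup>2) *\<^sub>R X \<omega>)))"

lemma C_lLip_comp_Lipschitz:
  fixes f :: "'a::euclidean_space \<Rightarrow> 'b::euclidean_space"
  assumes \<phi>: "\<phi> \<in> C_lLip" and f: "\<And>x y. norm (f x - f y) \<le> K * norm (x - y)"
  shows "(\<lambda>x. \<phi> (f x)) \<in> C_lLip"
proof -
  obtain C m where "C > 0" and C: "\<And>x y.
      \<bar>\<phi> x - \<phi> y\<bar> \<le> C * (1 + norm x ^ m + norm y ^ m) * norm (x - y)"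
    using \<phi> by (auto simp: C_lLip_def)
  define L where "L = max 1 (max (2 * norm (f 0)) (2 * K))"
  have L: "L \<ge> 1" "2 * norm (f 0) \<le> L" "2 * K \<le> L" by (auto simp: L_def)
  have growth: "norm (f x) ^ m \<le> L ^ m * (1 + norm x ^ m)" for x
  proof -
    have "norm (f x) \<le> norm (f 0) + norm (f x - f 0)"
      using norm_triangle_ineq[of "f 0" "f x - f 0"] by simp
    also have "\<dots> \<le> L / 2 + L / 2 * norm x"
      using f[of x 0] L mult_right_mono[of K "L / 2" "norm x"] by simp
    also have "\<dots> \<le> L * max 1 (norm x)"
    proof -
      have "L / 2 * 1 \<le> L / 2 * max 1 (norm x)" "L / 2 * norm x \<le> L / 2 * max 1 (norm x)"
        using L by (intro mult_left_mono; simp)+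
      then show ?thesis by simp
    qed
    finally have "norm (f x) ^ m \<le> (L * max 1 (norm x)) ^ m"
      by (intro power_mono) auto
    also have "\<dots> \<le> L ^ m * (1 + norm x ^ m)"
      using L by (auto simp: power_mult_distrib max_def)
    finally show ?thesis .
  qed
  have "\<bar>\<phi> (f x) - \<phi> (f y)\<bar> \<le> (3 * C * L ^ m * L) * (1 + norm x ^ m + norm y ^ m) * norm (x - y)" for x y
  proof -
    have L1: "L ^ m \<ge> 1" using L by simp
    have "1 + norm (f x) ^ m + norm (f y) ^ m
        \<le> L ^ m + L ^ m * (1 + norm x ^ m) + L ^ m * (1 + norm y ^ m)"
      using L1 growth[of x] growth[of y] by simp
    also have "\<dots> = L ^ m * (3 + norm x ^ m + norm y ^ m)"
      by (simp add: algebra_simps)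
    also have "\<dots> \<le> L ^ m * (3 * (1 + norm x ^ m + norm y ^ m))"
      using L1 by (intro mult_left_mono) auto
    finally have 1: "1 + norm (f x) ^ m + norm (f y) ^ m
        \<le> 3 * L ^ m * (1 + norm x ^ m + norm y ^ m)" by (simp add: algebra_simps)
    have "K * norm (x - y) \<le> L * norm (x - y)"
      using L by (intro mult_right_mono) auto
    then have 2: "norm (f x - f y) \<le> L * norm (x - y)"
      using f[of x y] by linarith
    have "\<bar>\<phi> (f x) - \<phi> (f y)\<bar> \<le> C * (1 + norm (f x) ^ m + norm (f y) ^ m) * norm (f x - f y)"
      by (rule C)
    also have "\<dots> \<le> C * (3 * L ^ m * (1 + norm x ^ m + norm y ^ m)) * (L * norm (x - y))"
      using \<open>C > 0\<close> L1 1 2 by (intro mult_mono mult_nonneg_nonneg) auto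
    finally show ?thesis by (simp add: mult_ac)
  qed
  moreover have "3 * C * L ^ m * L > 0" using \<open>C > 0\<close> L by simp
  ultimately show ?thesis unfolding C_lLip_def by blast
qed

lemma G_normal_iff_independent_copy:
  fixes X Xbar :: "'w \<Rightarrow> 'a::euclidean_space"
  assumes "random_vector H X" and copy: "independent_copy E X Xbar"
  shows "G_normal H E X \<longleftrightarrow>
    (\<forall>a\<ge>0. \<forall>b\<ge>0.
       same_distribution E (\<lambda>\<omega>. a *\<^sub>R X \<omega> + b *\<^sub>R Xbar \<omega>) (\<lambda>\<omega>. sqrt (a\<^sup>2 + b\<^sup>2) *\<^sub>R X \<omega>))"
proof -
  have "E (\<lambda>\<omega>. \<phi> (a *\<^sub>R X \<omega> + b *\<^sub>R Xbar \<omega>)) = E (\<lambda>\<omega>. E (\<lambda>\<omega>'. \<phi> (a *\<^sub>R X \<omega> + b *\<^sub>R X \<omega>')))"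
    if "a \<ge> 0" "b \<ge> 0" and \<phi>: "\<phi> \<in> C_lLip" for a b \<phi>
  proof -
    have "norm ((a *\<^sub>R fst p + b *\<^sub>R snd p) - (a *\<^sub>R fst q + b *\<^sub>R snd q)) \<le> (a + b) * norm (p - q)"
      for p q :: "'a \<times> 'a"
    proof -
      have "norm ((a *\<^sub>R fst p + b *\<^sub>R snd p) - (a *\<^sub>R fst q + b *\<^sub>R snd q))
          = norm (a *\<^sub>R fst (p - q) + b *\<^sub>R snd (p - q))"
        by (simp add: algebra_simps)
      also have "\<dots> \<le> a * norm (fst (p - q)) + b * norm (snd (p - q))"
        using norm_triangle_ineq[of "a *\<^sub>R fst (p - q)" "b *\<^sub>R snd (p - q)"] that by simp
      also have "\<dots> \<le> a * norm (p - q) + b * norm (p - q)"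
        using that norm_fst_le[of "fst (p - q)" "snd (p - q)"] norm_snd_le[of "snd (p - q)" "fst (p - q)"]
        unfolding prod.collapse by (intro add_mono mult_left_mono) simp_all
      finally show ?thesis by (simp add: algebra_simps)
    qed
    then have "(\<lambda>p. \<phi> (a *\<^sub>R fst p + b *\<^sub>R snd p)) \<in> C_lLip"
      by (rule C_lLip_comp_Lipschitz[OF \<phi>])
    then have "E (\<lambda>\<omega>. \<phi> (a *\<^sub>R X \<omega> + b *\<^sub>R Xbar \<omega>)) = E (\<lambda>\<omega>. E (\<lambda>\<omega>'. \<phi> (a *\<^sub>R X \<omega> + b *\<^sub>R Xbar \<omega>')))"
      using copy by (fastforce simp: independent_copy_def independent_from_def)
    moreover have shift: "(\<lambda>y. \<phi> (a *\<^sub>R x + b *\<^sub>R y)) \<in> C_lLip" for x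
      using that by (intro C_lLip_comp_Lipschitz[OF \<phi>, where K = b]) (simp flip: scaleR_diff_right)
    have "E (\<lambda>\<omega>'. \<phi> (a *\<^sub>R x + b *\<^sub>R Xbar \<omega>')) = E (\<lambda>\<omega>'. \<phi> (a *\<^sub>R x + b *\<^sub>R X \<omega>'))" for x
      using copy shift[of x] unfolding independent_copy_def same_distribution_def
      by (elim conjE) (drule (1) bspec, simp)
    ultimately show ?thesis by simp
  qed
  then show ?thesis
    using assms(1) by (simp add: G_normal_def same_distribution_def)
qed

definition covariance_set :: "(real ^ 'n ^ 'n) set \<Rightarrow> bool" where
  "covariance_set \<Gamma> \<longleftrightarrow> \<Gamma> \<noteq> {} \<and> bounded \<Gamma> \<and> closed \<Gamma> \<and> convex \<Gamma> \<and>
     (\<forall>B\<in>\<Gamma>. transpose B = B \<and> (\<forall>x. 0 \<le> x \<bullet> (B *v x)))"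

text \<open>\<open>normal_zero H E \<Gamma> X\<close> is the relation \<open>X \<sim> N(0, \<Gamma>)\<close>.\<close>

definition normal_zero ::
    "('w \<Rightarrow> real) set \<Rightarrow> (('w \<Rightarrow> real) \<Rightarrow> real) \<Rightarrow> (real ^ 'n ^ 'n) set \<Rightarrow> ('w \<Rightarrow> real ^ 'n) \<Rightarrow> bool" where
  "normal_zero H E \<Gamma> X \<longleftrightarrow> covariance_set \<Gamma> \<and> G_normal H E X \<and>
     (\<forall>A. transpose A = A \<longrightarrow>
        1 / 2 * E (\<lambda>\<omega>. (A *v X \<omega>) \<bullet> X \<omega>) = 1 / 2 * (SUP B\<in>\<Gamma>. trace (A ** B)))"

definition diag2 :: "real \<Rightarrow> real \<Rightarrow> real ^ 2 ^ 2" where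
  "diag2 r s = vector [vector [r, 0], vector [0, s]]"

lemma covariance_set_diag2:
  assumes "0 \<le> l" "l \<le> u"
  shows "covariance_set {diag2 r s | r s. r \<in> {l..u} \<and> s \<in> {l..u}}"
proof -
  define f :: "real \<times> real \<Rightarrow> real ^ 2 ^ 2" where "f p = diag2 (fst p) (snd p)" for p
  have lin: "linear f"
    by (rule linearI) (auto simp: f_def diag2_def vec_eq_iff forall_2)
  have eq: "{diag2 r s | r s. r \<in> {l..u} \<and> s \<in> {l..u}} = f ` ({l..u} \<times> {l..u})"
    unfolding f_def by (force simp: image_def)
  have "compact (f ` ({l..u} \<times> {l..u}))"
    using lin by (intro compact_continuous_image compact_Times linear_continuous_on)
      (auto simp: linear_conv_bounded_linear)
  moreover have "convex (f ` ({l..u} \<times> {l..u}))"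
    using lin by (intro convex_linear_image convex_Times) auto
  moreover have "transpose (f p) = f p" for p
    by (auto simp: f_def diag2_def vec_eq_iff forall_2 transpose_def)
  moreover have "0 \<le> x \<bullet> (f p *v x)" if "p \<in> {l..u} \<times> {l..u}" for p x
  proof -
    have "x \<bullet> (f p *v x) = fst p * (x $ 1)\<^sup>2 + snd p * (x $ 2)\<^sup>2"
      by (simp add: f_def diag2_def inner_vec_def matrix_vector_mult_def sum_2 power2_eq_square)
    then show ?thesis using that assms by auto
  qed
  ultimately show ?thesis
    unfolding covariance_set_def eq using assms by (auto simp: compact_imp_bounded compact_imp_closed)
qed

end

theory Submission
  imports Defs
begin

text \<open>
  Write \<open>P\<close> and \<open>Q\<close> for two linear functionals of a G-normal vector \<open>X\<close>, and suppose that \<open>Q\<close> is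
  independent from \<open>P\<close>. The proof compares two evaluations of the mixed third moment
  \<open>m = E[P Q\<^sup>2]\<close>.

  By independence, \<open>m = E[g(P)]\<close> with \<open>g(x) = E[x Q\<^sup>2]\<close>. The function \<open>g\<close> has slope
  \<open>s = E[Q\<^sup>2]\<close> on the right of \<open>0\<close> and slope \<open>l = -E[-Q\<^sup>2]\<close> on the left, and \<open>P\<close> has mean zero
  without uncertainty, so \<open>m = (s - l) E[P\<^sup>+]\<close>. This is positive if the variance of \<open>Q\<close> is uncertain
  and \<open>P\<close> is not degenerate (lemma \<open>mixed_third_moment_pos\<close>).

  On the other hand, G-normality says that \<open>X\<close> at scale \<open>sqrt (a\<^sup>2 + b\<^sup>2)\<close> is \<open>a X\<close> plus an
  independent increment \<open>b X'\<close>. Expanding the cubic \<open>(a P + b P') (a Q + b Q')\<^sup>2\<close>, the terms with a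
  factor of mean zero drop out: those linear in the increment, and the one with \<open>P' Q'\<close>, which has mean
  zero by independence. What is left gives (lemma \<open>G_normal_cubic_le\<close>)
  \[ (a^2 + b^2)^{3/2} m \le a^3 m + a b^2 E[g(P)] + b^3 m. \]
  With \<open>E[g(P)] = m\<close> this fails for \<open>m > 0\<close> and small \<open>b / a\<close>: with \<open>a = 1\<close>, the factor of \<open>m\<close> is
  \<open>1 + 3/2 b\<^sup>2\<close> to second order on the left, but \<open>1 + b\<^sup>2\<close> on the right. In terms of processes, independence
  lets the variance of \<open>Q\<close> react to the final value of \<open>P\<close>, whereas under G-normality it can react
  only to the current value of a \<open>P\<close> that is evolving simultaneously.

  Hence the variance of \<open>Q\<close> is certain or \<open>P\<close> is degenerate (theorem
  \<open>G_normal_independent_imp_certain_variance\<close>). For the given \<open>\<Gamma>\<close> neither happens for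
  any nonzero functional, and the rows of an invertible matrix are nonzero.
\<close>

section \<open>Products of locally Lipschitz functions\<close>

text \<open>
  Powers of \<open>1 + norm x + norm y\<close> multiply by adding exponents, which makes this form of the growth
  condition easier to use for products than the sum of powers in the definition.
\<close>

lemma C_lLip_iff:
  fixes \<phi> :: "'a::euclidean_space \<Rightarrow> real"
  shows "\<phi> \<in> C_lLip \<longleftrightarrow>
    (\<exists>C m. \<forall>x y. \<bar>\<phi> x - \<phi> y\<bar> \<le> C * (1 + norm x + norm y) ^ m * norm (x - y))"
proof
  assume "\<phi> \<in> C_lLip"
  then obtain C m where "C > 0" and C: "\<And>x y.
      \<bar>\<phi> x - \<phi> y\<bar> \<le> C * (1 + norm x ^ m + norm y ^ m) * norm (x - y)"
    by (auto simp: C_lLip_def)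
  have "\<bar>\<phi> x - \<phi> y\<bar> \<le> (3 * C) * (1 + norm x + norm y) ^ m * norm (x - y)" for x y
  proof -
    have "norm x ^ m \<le> (1 + norm x + norm y) ^ m" "norm y ^ m \<le> (1 + norm x + norm y) ^ m"
      by (intro power_mono; simp)+
    moreover have "1 \<le> (1 + norm x + norm y) ^ m"
      by (intro one_le_power) simp
    ultimately have "1 + norm x ^ m + norm y ^ m \<le> 3 * (1 + norm x + norm y) ^ m"
      by linarith
    then have "C * (1 + norm x ^ m + norm y ^ m) * norm (x - y)
        \<le> C * (3 * (1 + norm x + norm y) ^ m) * norm (x - y)"
      using \<open>C > 0\<close> by (intro mult_right_mono mult_left_mono) auto
    then show ?thesis using C[of x y] by (simp add: mult_ac)
  qed
  then show "\<exists>C m. \<forall>x y. \<bar>\<phi> x - \<phi> y\<bar> \<le> C * (1 + norm x + norm y) ^ m * norm (x - y)"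
    by blast
next
  assume "\<exists>C m. \<forall>x y. \<bar>\<phi> x - \<phi> y\<bar> \<le> C * (1 + norm x + norm y) ^ m * norm (x - y)"
  then obtain C m where C: "\<And>x y.
      \<bar>\<phi> x - \<phi> y\<bar> \<le> C * (1 + norm x + norm y) ^ m * norm (x - y)"
    by blast
  have "\<bar>\<phi> x - \<phi> y\<bar> \<le> ((\<bar>C\<bar> + 1) * 3 ^ m) * (1 + norm x ^ m + norm y ^ m) * norm (x - y)" for x y
  proof -
    define M where "M = max 1 (max (norm x) (norm y))"
    have "(1 + norm x + norm y) ^ m \<le> (3 * M) ^ m"
      by (intro power_mono) (auto simp: M_def)
    moreover have "M ^ m \<le> 1 + norm x ^ m + norm y ^ m"
      by (auto simp: M_def max_def)
    ultimately have le: "(1 + norm x + norm y) ^ m \<le> 3 ^ m * (1 + norm x ^ m + norm y ^ m)"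
      unfolding power_mult_distrib
      by (meson mult_left_mono order_trans zero_le_numeral zero_le_power)
    have "C * (1 + norm x + norm y) ^ m \<le> (\<bar>C\<bar> + 1) * (3 ^ m * (1 + norm x ^ m + norm y ^ m))"
      using le by (intro mult_mono) auto
    then have "C * (1 + norm x + norm y) ^ m * norm (x - y)
        \<le> (\<bar>C\<bar> + 1) * (3 ^ m * (1 + norm x ^ m + norm y ^ m)) * norm (x - y)"
      by (rule mult_right_mono) simp
    then show ?thesis using C[of x y] by (simp add: mult_ac)
  qed
  moreover have "(\<bar>C\<bar> + 1) * 3 ^ m > 0"
    by (intro mult_pos_pos) auto
  ultimately show "\<phi> \<in> C_lLip"
    unfolding C_lLip_def by blast
qed

lemma C_lLip_mult:
  fixes \<phi> \<psi> :: "'a::euclidean_space \<Rightarrow> real"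
  assumes "\<phi> \<in> C_lLip" "\<psi> \<in> C_lLip"
  shows "(\<lambda>x. \<phi> x * \<psi> x) \<in> C_lLip"
proof -
  have growth: "\<exists>D\<ge>0. \<exists>k. \<forall>x y :: 'a. \<bar>f x\<bar> \<le> D * (1 + norm x + norm y) ^ k"
    if "f \<in> C_lLip" for f :: "'a \<Rightarrow> real"
  proof -
    obtain C m where C: "\<And>x y. \<bar>f x - f y\<bar> \<le> C * (1 + norm x + norm y) ^ m * norm (x - y)"
      using \<open>f \<in> C_lLip\<close> unfolding C_lLip_iff by blast
    have "\<bar>f x\<bar> \<le> (\<bar>C\<bar> + \<bar>f 0\<bar>) * (1 + norm x + norm y) ^ Suc m" for x y :: 'a
    proof -
      have "C * (1 + norm x) ^ m * norm x \<le> \<bar>C\<bar> * (1 + norm x + norm y) ^ m * (1 + norm x + norm y)"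
        by (intro mult_mono power_mono) auto
      moreover have "\<bar>f 0\<bar> * 1 \<le> \<bar>f 0\<bar> * (1 + norm x + norm y) ^ Suc m"
        by (intro mult_left_mono one_le_power) auto
      moreover have "\<bar>f x\<bar> \<le> C * (1 + norm x) ^ m * norm x + \<bar>f 0\<bar>"
        using C[of x 0] by simp
      ultimately show ?thesis by (simp add: algebra_simps)
    qed
    then show ?thesis
      by (intro exI[of _ "\<bar>C\<bar> + \<bar>f 0\<bar>"] conjI exI[of _ "Suc m"] allI) auto
  qed
  obtain C m where C: "\<And>x y. \<bar>\<phi> x - \<phi> y\<bar> \<le> C * (1 + norm x + norm y) ^ m * norm (x - y)"
    using assms(1) unfolding C_lLip_iff by blast
  obtain C' m' where C': "\<And>x y. \<bar>\<psi> x - \<psi> y\<bar> \<le> C' * (1 + norm x + norm y) ^ m' * norm (x - y)"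
    using assms(2) unfolding C_lLip_iff by blast
  obtain D k where "D \<ge> 0" and D: "\<And>x y :: 'a. \<bar>\<phi> x\<bar> \<le> D * (1 + norm x + norm y) ^ k"
    using growth[OF assms(1)] by blast
  obtain D' k' where "D' \<ge> 0" and D': "\<And>x y :: 'a. \<bar>\<psi> x\<bar> \<le> D' * (1 + norm x + norm y) ^ k'"
    using growth[OF assms(2)] by blast
  define j where "j = (k + m') + (k' + m)"
  have "\<bar>\<phi> x * \<psi> x - \<phi> y * \<psi> y\<bar>
      \<le> (D * \<bar>C'\<bar> + D' * \<bar>C\<bar>) * (1 + norm x + norm y) ^ j * norm (x - y)" for x y
  proof -
    define B where "B = 1 + norm x + norm y"
    have "B \<ge> 1" by (simp add: B_def)
    have "\<phi> x * \<psi> x - \<phi> y * \<psi> y = \<phi> x * (\<psi> x - \<psi> y) + \<psi> y * (\<phi> x - \<phi> y)"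
      by (simp add: algebra_simps)
    then have "\<bar>\<phi> x * \<psi> x - \<phi> y * \<psi> y\<bar> \<le> \<bar>\<phi> x\<bar> * \<bar>\<psi> x - \<psi> y\<bar> + \<bar>\<psi> y\<bar> * \<bar>\<phi> x - \<phi> y\<bar>"
      by (metis abs_mult abs_triangle_ineq)
    also have "\<dots> \<le> (D * B ^ k) * (\<bar>C'\<bar> * B ^ m' * norm (x - y))
        + (D' * B ^ k') * (\<bar>C\<bar> * B ^ m * norm (x - y))"
    proof -
      have abs_le: "c * B ^ n * norm (x - y) \<le> \<bar>c\<bar> * B ^ n * norm (x - y)" for c n
        using \<open>B \<ge> 1\<close> by (intro mult_right_mono) auto
      show ?thesis
        using C[of x y] C'[of x y] D[of x y] D'[of y x] abs_le[of C m] abs_le[of C' m']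
          \<open>D \<ge> 0\<close> \<open>D' \<ge> 0\<close> \<open>B \<ge> 1\<close>
        by (intro add_mono mult_mono) (auto simp: B_def add_ac)
    qed
    also have "\<dots> = (D * \<bar>C'\<bar>) * B ^ (k + m') * norm (x - y) + (D' * \<bar>C\<bar>) * B ^ (k' + m) * norm (x - y)"
      by (simp add: power_add)
    also have "\<dots> \<le> (D * \<bar>C'\<bar>) * B ^ j * norm (x - y) + (D' * \<bar>C\<bar>) * B ^ j * norm (x - y)"
      using \<open>B \<ge> 1\<close> \<open>D \<ge> 0\<close> \<open>D' \<ge> 0\<close>
      by (intro add_mono mult_right_mono mult_left_mono power_increasing) (auto simp: j_def)
    finally show ?thesis by (simp add: B_def algebra_simps)
  qed
  then show ?thesis unfolding C_lLip_iff by blast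
qed

lemma Lipschitz_imp_C_lLip:
  fixes f :: "'a::euclidean_space \<Rightarrow> real"
  assumes "\<And>x y. \<bar>f x - f y\<bar> \<le> K * norm (x - y)"
  shows "f \<in> C_lLip"
  unfolding C_lLip_iff using assms by (intro exI[of _ K] exI[of _ 0]) simp

lemma C_lLip_bounded_linear:
  fixes f :: "'a::euclidean_space \<Rightarrow> real"
  assumes "bounded_linear f"
  shows "f \<in> C_lLip"
proof -
  interpret bounded_linear f by fact
  show ?thesis
    using bounded by (metis Lipschitz_imp_C_lLip diff mult.commute real_norm_def)
qed

section \<open>Calculus in a sublinear expectation space\<close>

context sublinear_expectation_space
begin

lemma uminus_mem: "X \<in> H \<Longrightarrow> (\<lambda>\<omega>. - X \<omega>) \<in> H"
  using scale_mem[of X "-1"] by simp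

lemma diff_mem: "X \<in> H \<Longrightarrow> Y \<in> H \<Longrightarrow> (\<lambda>\<omega>. X \<omega> - Y \<omega>) \<in> H"
  using add_mem[OF _ uminus_mem] by simp

lemma Lipschitz_comp_mem:
  assumes "X \<in> H" "\<And>x y :: real. \<bar>f x - f y\<bar> \<le> K * \<bar>x - y\<bar>"
  shows "(\<lambda>\<omega>. f (X \<omega>)) \<in> H"
  using assms by (intro C_lLip_comp_mem[where \<phi> = f] Lipschitz_imp_C_lLip[where K = K])
    (auto simp: random_vector_real)

lemma abs_mem: "X \<in> H \<Longrightarrow> (\<lambda>\<omega>. \<bar>X \<omega>\<bar>) \<in> H"
  by (rule Lipschitz_comp_mem[where K = 1]) auto

lemma pos_part_mem: "X \<in> H \<Longrightarrow> (\<lambda>\<omega>. max 0 (X \<omega>)) \<in> H"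
  by (rule Lipschitz_comp_mem[where K = 1]) auto

lemma mult_mem:
  assumes "X \<in> H" "Y \<in> H"
  shows "(\<lambda>\<omega>. X \<omega> * Y \<omega>) \<in> H"
proof -
  have "random_vector H (\<lambda>\<omega>. (X \<omega>, Y \<omega>))"
    using assms by (auto simp: random_vector_def Basis_prod_def)
  moreover have "(\<lambda>p. fst p * snd p) \<in> (C_lLip :: (real \<times> real \<Rightarrow> real) set)"
    by (intro C_lLip_mult C_lLip_bounded_linear bounded_linear_fst bounded_linear_snd)
  ultimately show ?thesis
    using C_lLip_comp_mem by fastforce
qed

lemma power_mem: "X \<in> H \<Longrightarrow> (\<lambda>\<omega>. X \<omega> ^ n) \<in> H"
  by (induction n) (auto intro: const_mem mult_mem)

lemmas mem_intros = const_mem add_mem diff_mem uminus_mem mult_mem power_mem abs_mem pos_part_mem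

lemma E_diff_le:
  assumes "X \<in> H" "Y \<in> H"
  shows "E X - E Y \<le> E (\<lambda>\<omega>. X \<omega> - Y \<omega>)"
  using E_subadd[of "\<lambda>\<omega>. X \<omega> - Y \<omega>" Y] assms diff_mem[of X Y] by simp

lemma E_scale:
  assumes "X \<in> H"
  shows "E (\<lambda>\<omega>. c * X \<omega>) = (if 0 \<le> c then c * E X else - c * E (\<lambda>\<omega>. - X \<omega>))"
  using E_pos_hom[OF assms, of c] E_pos_hom[OF uminus_mem[OF assms], of "- c"] by simp

text \<open>
  Random variables of mean zero without uncertainty are the ones that can be dropped from under \<open>E\<close>;
  \<open>E X = 0\<close> alone would not suffice.
\<close>

definition mean_zero :: "('w \<Rightarrow> real) \<Rightarrow> bool" where
  "mean_zero X \<longleftrightarrow> X \<in> H \<and> E X = 0 \<and> E (\<lambda>\<omega>. - X \<omega>) = 0"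

lemma E_add_mean_zero:
  assumes "X \<in> H" "mean_zero Y"
  shows "E (\<lambda>\<omega>. X \<omega> + Y \<omega>) = E X"
proof (rule antisym)
  show "E (\<lambda>\<omega>. X \<omega> + Y \<omega>) \<le> E X"
    using E_subadd[of X Y] assms by (simp add: mean_zero_def)
  show "E X \<le> E (\<lambda>\<omega>. X \<omega> + Y \<omega>)"
    using E_subadd[of "\<lambda>\<omega>. X \<omega> + Y \<omega>" "\<lambda>\<omega>. - Y \<omega>"] assms
    by (simp add: mean_zero_def mem_intros)
qed

lemma mean_zero_scale: "mean_zero X \<Longrightarrow> mean_zero (\<lambda>\<omega>. c * X \<omega>)"
  using E_scale[of X c] E_scale[of X "- c"] by (auto simp: mean_zero_def scale_mem)

lemma mean_zero_add:
  assumes "mean_zero X" "mean_zero Y"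
  shows "mean_zero (\<lambda>\<omega>. X \<omega> + Y \<omega>)"
  using E_add_mean_zero[of X Y] E_add_mean_zero[of "\<lambda>\<omega>. - X \<omega>" "\<lambda>\<omega>. - Y \<omega>"] assms
  by (auto simp: mean_zero_def mem_intros)

lemma E_const_add:
  assumes "X \<in> H"
  shows "E (\<lambda>\<omega>. c + X \<omega>) = c + E X"
proof (rule antisym)
  show "E (\<lambda>\<omega>. c + X \<omega>) \<le> c + E X"
    using E_subadd[OF const_mem assms, of c] by (simp add: E_const)
  show "c + E X \<le> E (\<lambda>\<omega>. c + X \<omega>)"
    using E_diff_le[OF assms, of "\<lambda>\<omega>. c + X \<omega>"] E_subadd[of "\<lambda>\<omega>. c + X \<omega>" "\<lambda>\<omega>. - c"] assms
    by (simp add: mem_intros E_const)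
qed

text \<open>
  Monotonicity of the outer expectation is available on \<open>H\<close> only, so iterated expectations must be
  shown to have their inner expectation in \<open>H\<close>: it depends on the outer variable in a Lipschitz way.
\<close>

lemma E_affine_mem:
  assumes "X \<in> H" "Y \<in> H" "Z \<in> H"
  shows "(\<lambda>\<omega>. E (\<lambda>\<omega>'. X \<omega> * Y \<omega>' + Z \<omega>')) \<in> H"
proof (rule Lipschitz_comp_mem[OF \<open>X \<in> H\<close>, where f = "\<lambda>x. E (\<lambda>\<omega>'. x * Y \<omega>' + Z \<omega>')"])
  fix x y :: real
  have le: "E (\<lambda>\<omega>. x * Y \<omega> + Z \<omega>) - E (\<lambda>\<omega>. y * Y \<omega> + Z \<omega>) \<le> E (\<lambda>\<omega>. \<bar>Y \<omega>\<bar>) * \<bar>x - y\<bar>" for x y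
  proof -
    have "E (\<lambda>\<omega>. x * Y \<omega> + Z \<omega>) - E (\<lambda>\<omega>. y * Y \<omega> + Z \<omega>)
        \<le> E (\<lambda>\<omega>. (x * Y \<omega> + Z \<omega>) - (y * Y \<omega> + Z \<omega>))"
      using assms by (intro E_diff_le mem_intros)
    also have "\<dots> \<le> E (\<lambda>\<omega>. \<bar>x - y\<bar> * \<bar>Y \<omega>\<bar>)"
    proof (intro E_mono mem_intros assms)
      show "(x * Y \<omega> + Z \<omega>) - (y * Y \<omega> + Z \<omega>) \<le> \<bar>x - y\<bar> * \<bar>Y \<omega>\<bar>" for \<omega>
        using abs_ge_self[of "(x - y) * Y \<omega>"] unfolding abs_mult by (simp add: left_diff_distrib)
    qed
    also have "\<dots> = E (\<lambda>\<omega>. \<bar>Y \<omega>\<bar>) * \<bar>x - y\<bar>"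
      using assms by (simp add: E_pos_hom mem_intros)
    finally show ?thesis .
  qed
  show "\<bar>E (\<lambda>\<omega>. x * Y \<omega> + Z \<omega>) - E (\<lambda>\<omega>. y * Y \<omega> + Z \<omega>)\<bar> \<le> E (\<lambda>\<omega>. \<bar>Y \<omega>\<bar>) * \<bar>x - y\<bar>"
    using le[of x y] le[of y x] by (simp add: abs_le_iff abs_minus_commute)
qed

text \<open>
  Since \<open>P\<close> has mean zero, \<open>E[P\<^sup>+] = E\<bar>P\<bar> / 2\<close>. If this were zero, splitting at \<open>\<bar>P\<bar> = c\<close>
  would give \<open>E[P\<^sup>2] \<le> E[P\<^sup>4] / c\<^sup>2\<close> for all \<open>c > 0\<close>.
\<close>

lemma E_pos_part_pos:
  assumes P: "mean_zero P" and pos: "E (\<lambda>\<omega>. (P \<omega>)\<^sup>2) > 0"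
  shows "E (\<lambda>\<omega>. max 0 (P \<omega>)) > 0"
proof (rule ccontr)
  have "P \<in> H" using P by (simp add: mean_zero_def)
  assume "\<not> ?thesis"
  moreover have "E (\<lambda>\<omega>. \<bar>P \<omega>\<bar>) = 2 * E (\<lambda>\<omega>. max 0 (P \<omega>))"
  proof -
    have "E (\<lambda>\<omega>. 2 * max 0 (P \<omega>) + (-1) * P \<omega>) = E (\<lambda>\<omega>. 2 * max 0 (P \<omega>))"
      using \<open>P \<in> H\<close> by (intro E_add_mean_zero mean_zero_scale P mem_intros)
    moreover have "(\<lambda>\<omega>. \<bar>P \<omega>\<bar>) = (\<lambda>\<omega>. 2 * max 0 (P \<omega>) + (-1) * P \<omega>)"
      by (auto simp: max_def)
    ultimately show ?thesis
      using E_pos_hom[OF pos_part_mem[OF \<open>P \<in> H\<close>], of 2] by simp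
  qed
  ultimately have abs: "E (\<lambda>\<omega>. \<bar>P \<omega>\<bar>) \<le> 0" by simp
  define v where "v = E (\<lambda>\<omega>. (P \<omega>)\<^sup>2)"
  define k where "k = E (\<lambda>\<omega>. (P \<omega>) ^ 4)"
  have bound: "v * c\<^sup>2 \<le> k" if "c > 0" for c
  proof -
    have "v \<le> E (\<lambda>\<omega>. c * \<bar>P \<omega>\<bar> + (1 / c\<^sup>2) * (P \<omega>) ^ 4)"
      unfolding v_def
    proof (intro E_mono mem_intros \<open>P \<in> H\<close>)
      fix \<omega>
      show "(P \<omega>)\<^sup>2 \<le> c * \<bar>P \<omega>\<bar> + (1 / c\<^sup>2) * (P \<omega>) ^ 4"
      proof (cases "\<bar>P \<omega>\<bar> \<le> c")
        case True
        then have "\<bar>P \<omega>\<bar> * \<bar>P \<omega>\<bar> \<le> c * \<bar>P \<omega>\<bar>" by (intro mult_right_mono) auto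
        then have "(P \<omega>)\<^sup>2 \<le> c * \<bar>P \<omega>\<bar>" by (simp add: power2_eq_square)
        moreover have "0 \<le> (1 / c\<^sup>2) * (P \<omega>) ^ 4" by simp
        ultimately show ?thesis by linarith
      next
        case False
        then have "c\<^sup>2 \<le> (P \<omega>)\<^sup>2" using that by (simp add: abs_le_square_iff[symmetric])
        then have "c\<^sup>2 * (P \<omega>)\<^sup>2 \<le> (P \<omega>)\<^sup>2 * (P \<omega>)\<^sup>2" by (intro mult_right_mono) auto
        then have "(P \<omega>)\<^sup>2 \<le> (1 / c\<^sup>2) * (P \<omega>) ^ 4"
          using that by (simp add: field_simps flip: power_add)
        moreover have "0 \<le> c * \<bar>P \<omega>\<bar>" using that by simp
        ultimately show ?thesis by linarith
      qed
    qed
    also have "\<dots> \<le> E (\<lambda>\<omega>. c * \<bar>P \<omega>\<bar>) + E (\<lambda>\<omega>. (1 / c\<^sup>2) * (P \<omega>) ^ 4)"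
      using \<open>P \<in> H\<close> by (intro E_subadd mem_intros)
    also have "\<dots> = c * E (\<lambda>\<omega>. \<bar>P \<omega>\<bar>) + (1 / c\<^sup>2) * k"
      using E_pos_hom[OF abs_mem[OF \<open>P \<in> H\<close>], of c]
        E_pos_hom[OF power_mem[OF \<open>P \<in> H\<close>, of 4], of "1 / c\<^sup>2"] that by (simp add: k_def)
    also have "\<dots> \<le> (1 / c\<^sup>2) * k"
      using abs that by (simp add: mult_le_0_iff)
    finally show ?thesis using that by (simp add: field_simps)
  qed
  have "v > 0" using pos by (simp add: v_def)
  define c where "c = sqrt ((\<bar>k\<bar> + 1) / v)"
  have "c > 0" "v * c\<^sup>2 = \<bar>k\<bar> + 1"
    using \<open>v > 0\<close> by (auto simp: c_def)
  then show False using bound[of c] by simp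
qed

lemma mixed_third_moment_pos:
  assumes P: "mean_zero P" and Q: "Q \<in> H"
    and nondegenerate: "E (\<lambda>\<omega>. (P \<omega>)\<^sup>2) > 0"
    and uncertain: "- E (\<lambda>\<omega>. - (Q \<omega>)\<^sup>2) < E (\<lambda>\<omega>. (Q \<omega>)\<^sup>2)"
  shows "E (\<lambda>\<omega>. E (\<lambda>\<omega>'. P \<omega> * (Q \<omega>')\<^sup>2)) > 0"
proof -
  define s where "s = E (\<lambda>\<omega>. (Q \<omega>)\<^sup>2)"
  define l where "l = - E (\<lambda>\<omega>. - (Q \<omega>)\<^sup>2)"
  have "P \<in> H" using P by (simp add: mean_zero_def)
  have "E (\<lambda>\<omega>'. x * (Q \<omega>')\<^sup>2) = (s - l) * max 0 x + l * x" for x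
    using E_scale[OF power_mem[OF Q, of 2], of x] by (auto simp: s_def l_def max_def algebra_simps)
  then have "E (\<lambda>\<omega>. E (\<lambda>\<omega>'. P \<omega> * (Q \<omega>')\<^sup>2)) = E (\<lambda>\<omega>. (s - l) * max 0 (P \<omega>) + l * P \<omega>)"
    by simp
  also have "\<dots> = E (\<lambda>\<omega>. (s - l) * max 0 (P \<omega>))"
    using \<open>P \<in> H\<close> by (intro E_add_mean_zero mean_zero_scale P mem_intros)
  also have "\<dots> = (s - l) * E (\<lambda>\<omega>. max 0 (P \<omega>))"
    using uncertain \<open>P \<in> H\<close> by (intro E_pos_hom mem_intros) (simp_all add: s_def l_def)
  also have "\<dots> > 0"
    using uncertain E_pos_part_pos[OF P nondegenerate] by (intro mult_pos_pos) (simp_all add: s_def l_def)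
  finally show ?thesis .
qed

lemma independent_imp_mult_mean_zero:
  fixes P Q :: "'w \<Rightarrow> real"
  assumes indep: "independent_from E Q P" and P: "P \<in> H" and Q: "mean_zero Q"
  shows "mean_zero (\<lambda>\<omega>. P \<omega> * Q \<omega>)"
proof -
  have "E (\<lambda>\<omega>. c * (P \<omega> * Q \<omega>)) = 0" for c
  proof -
    have "bounded_linear (\<lambda>p :: real \<times> real. c * fst p)"
      by (intro bounded_linear_mult_right bounded_linear_compose[OF _ bounded_linear_fst])
    then have "(\<lambda>p. (c * fst p) * snd p) \<in> (C_lLip :: (real \<times> real \<Rightarrow> real) set)"
      by (intro C_lLip_mult C_lLip_bounded_linear bounded_linear_snd)
    then have "E (\<lambda>\<omega>. c * P \<omega> * Q \<omega>) = E (\<lambda>\<omega>. E (\<lambda>\<omega>'. c * P \<omega> * Q \<omega>'))"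
      using indep unfolding independent_from_def by fastforce
    also have "(\<lambda>\<omega>. E (\<lambda>\<omega>'. c * P \<omega> * Q \<omega>')) = (\<lambda>\<omega>. 0)"
      using mean_zero_scale[OF Q] by (simp add: mean_zero_def)
    finally show ?thesis by (simp add: E_const mult.assoc)
  qed
  from this[of 1] this[of "-1"] show ?thesis
    using P Q by (simp add: mean_zero_def mem_intros)
qed

section \<open>Moments of G-normal vectors\<close>

lemma G_normalD:
  fixes X :: "'w \<Rightarrow> 'a::euclidean_space"
  assumes "G_normal H E X" "0 \<le> a" "0 \<le> b" "\<phi> \<in> C_lLip"
  shows "E (\<lambda>\<omega>. E (\<lambda>\<omega>'. \<phi> (a *\<^sub>R X \<omega> + b *\<^sub>R X \<omega>'))) = E (\<lambda>\<omega>. \<phi> (sqrt (a\<^sup>2 + b\<^sup>2) *\<^sub>R X \<omega>))"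
  using assms by (simp add: G_normal_def)

lemma random_vector_inner_mem:
  fixes X :: "'w \<Rightarrow> 'a::euclidean_space"
  assumes "random_vector H X"
  shows "(\<lambda>\<omega>. X \<omega> \<bullet> v) \<in> H"
  using assms by (intro C_lLip_comp_mem[where \<phi> = "\<lambda>x. x \<bullet> v"] C_lLip_bounded_linear)
    (auto intro: bounded_linear_inner_left)

lemma G_normal_inner_mean_zero:
  fixes X :: "'w \<Rightarrow> 'a::euclidean_space"
  assumes G: "G_normal H E X"
  shows "mean_zero (\<lambda>\<omega>. X \<omega> \<bullet> v)"
proof -
  have rv: "random_vector H X" using G by (simp add: G_normal_def)
  have zero: "E (\<lambda>\<omega>. X \<omega> \<bullet> w) = 0" for w
  proof -
    define e where "e = E (\<lambda>\<omega>. X \<omega> \<bullet> w)"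
    have scale: "E (\<lambda>\<omega>. c * (X \<omega> \<bullet> w)) = c * e" if "c \<ge> 0" for c
      using E_pos_hom[OF random_vector_inner_mem[OF rv] that] by (simp add: e_def)
    have "(\<lambda>x. x \<bullet> w) \<in> C_lLip"
      by (intro C_lLip_bounded_linear bounded_linear_inner_left)
    \<comment> \<open>The triple 3, 4, 5 keeps the square root rational.\<close>
    then have "E (\<lambda>\<omega>. E (\<lambda>\<omega>'. (3 *\<^sub>R X \<omega> + 4 *\<^sub>R X \<omega>') \<bullet> w))
        = E (\<lambda>\<omega>. (sqrt (3\<^sup>2 + 4\<^sup>2) *\<^sub>R X \<omega>) \<bullet> w)"
      by (intro G_normalD[OF G, where \<phi> = "\<lambda>x. x \<bullet> w"]) simp_all
    moreover have "sqrt (3\<^sup>2 + 4\<^sup>2) = (5::real)"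
      by (rule real_sqrt_unique) auto
    moreover have "E (\<lambda>\<omega>'. x + 4 * (X \<omega>' \<bullet> w)) = 4 * e + x" for x
      using random_vector_inner_mem[OF rv] by (subst E_const_add) (auto simp: scale intro!: mem_intros)
    moreover have "E (\<lambda>\<omega>. 4 * e + 3 * (X \<omega> \<bullet> w)) = 4 * e + 3 * e"
      using random_vector_inner_mem[OF rv] by (subst E_const_add) (auto simp: scale intro!: mem_intros)
    ultimately show "e = 0"
      by (simp add: inner_add_left scale)
  qed
  show ?thesis
    using zero[of v] zero[of "- v"] random_vector_inner_mem[OF rv] by (simp add: mean_zero_def)
qed

text \<open>
  The growth of the mixed third moment over an increment of size \<open>b\<close>. The uncertain second-order
  term is \<open>a b\<^sup>2 P Q'\<^sup>2\<close>, in which the increment sees only the value of \<open>P\<close> before it.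
\<close>

lemma G_normal_cubic_le:
  fixes X :: "'w \<Rightarrow> 'a::euclidean_space" and u v :: 'a
  defines "P \<equiv> \<lambda>\<omega>. X \<omega> \<bullet> u" and "Q \<equiv> \<lambda>\<omega>. X \<omega> \<bullet> v"
  assumes G: "G_normal H E X" and PQ: "mean_zero (\<lambda>\<omega>. P \<omega> * Q \<omega>)" and ab: "0 \<le> a" "0 \<le> b"
  shows "sqrt (a\<^sup>2 + b\<^sup>2) ^ 3 * E (\<lambda>\<omega>. P \<omega> * (Q \<omega>)\<^sup>2)
    \<le> a ^ 3 * E (\<lambda>\<omega>. P \<omega> * (Q \<omega>)\<^sup>2) + a * b\<^sup>2 * E (\<lambda>\<omega>. E (\<lambda>\<omega>'. P \<omega> * (Q \<omega>')\<^sup>2))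
      + b ^ 3 * E (\<lambda>\<omega>. P \<omega> * (Q \<omega>)\<^sup>2)"
proof -
  define m where "m = E (\<lambda>\<omega>. P \<omega> * (Q \<omega>)\<^sup>2)"
  define r where "r = sqrt (a\<^sup>2 + b\<^sup>2)"
  have P: "mean_zero P" and Q: "mean_zero Q"
    unfolding P_def Q_def by (intro G_normal_inner_mean_zero G)+
  then have mem: "P \<in> H" "Q \<in> H" by (simp_all add: mean_zero_def)
  note mems = mem_intros mem
  have m_scale: "E (\<lambda>\<omega>. c * (P \<omega> * (Q \<omega>)\<^sup>2)) = c * m" if "c \<ge> 0" for c
    unfolding m_def using that by (intro E_pos_hom mems)
  have "(\<lambda>x. (x \<bullet> u) * ((x \<bullet> v) * (x \<bullet> v))) \<in> C_lLip"
    by (intro C_lLip_mult C_lLip_bounded_linear bounded_linear_inner_left)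
  then have "E (\<lambda>\<omega>. E (\<lambda>\<omega>'. ((a *\<^sub>R X \<omega> + b *\<^sub>R X \<omega>') \<bullet> u) *
        (((a *\<^sub>R X \<omega> + b *\<^sub>R X \<omega>') \<bullet> v) * ((a *\<^sub>R X \<omega> + b *\<^sub>R X \<omega>') \<bullet> v))))
      = E (\<lambda>\<omega>. ((r *\<^sub>R X \<omega>) \<bullet> u) * (((r *\<^sub>R X \<omega>) \<bullet> v) * ((r *\<^sub>R X \<omega>) \<bullet> v)))"
    unfolding r_def
    by (rule G_normalD[OF G ab, where \<phi> = "\<lambda>x. (x \<bullet> u) * ((x \<bullet> v) * (x \<bullet> v))"])
  also have "\<dots> = E (\<lambda>\<omega>. r ^ 3 * (P \<omega> * (Q \<omega>)\<^sup>2))"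
    by (rule arg_cong[where f = E])
      (simp add: fun_eq_iff P_def Q_def power2_eq_square power3_eq_cube mult_ac)
  also have "\<dots> = r ^ 3 * m"
    by (rule m_scale) (simp add: r_def)
  finally have "r ^ 3 * m = E (\<lambda>\<omega>. E (\<lambda>\<omega>'. (a * P \<omega> + b * P \<omega>') *
      ((a * Q \<omega> + b * Q \<omega>') * (a * Q \<omega> + b * Q \<omega>'))))"
    by (simp add: P_def Q_def inner_add_left)
  also have "\<dots> = E (\<lambda>\<omega>. a ^ 3 * (P \<omega> * (Q \<omega>)\<^sup>2)
      + E (\<lambda>\<omega>'. P \<omega> * (a * b\<^sup>2 * (Q \<omega>')\<^sup>2) + b ^ 3 * (P \<omega>' * (Q \<omega>')\<^sup>2)))"
  proof -
    have "E (\<lambda>\<omega>'. (a * p + b * P \<omega>') * ((a * q + b * Q \<omega>') * (a * q + b * Q \<omega>')))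
        = a ^ 3 * (p * q\<^sup>2) + E (\<lambda>\<omega>'. p * (a * b\<^sup>2 * (Q \<omega>')\<^sup>2) + b ^ 3 * (P \<omega>' * (Q \<omega>')\<^sup>2))"
      (is "?lhs = ?c + E ?Z") for p q
    proof -
      let ?N = "\<lambda>\<omega>. (a\<^sup>2 * b * q\<^sup>2) * P \<omega> + (2 * a\<^sup>2 * b * p * q) * Q \<omega>
        + (2 * a * b\<^sup>2 * q) * (P \<omega> * Q \<omega>)"
      have "?lhs = E (\<lambda>\<omega>. (?c + ?Z \<omega>) + ?N \<omega>)"
        by (rule arg_cong[where f = E])
          (simp add: fun_eq_iff algebra_simps power2_eq_square power3_eq_cube)
      also have "\<dots> = E (\<lambda>\<omega>. ?c + ?Z \<omega>)"
        by (intro E_add_mean_zero mean_zero_add mean_zero_scale P Q PQ mems)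
      also have "\<dots> = ?c + E ?Z"
        by (intro E_const_add mems)
      finally show ?thesis .
    qed
    then show ?thesis by simp
  qed
  also have "\<dots> \<le> E (\<lambda>\<omega>. a ^ 3 * (P \<omega> * (Q \<omega>)\<^sup>2) + (a * b\<^sup>2 * E (\<lambda>\<omega>'. P \<omega> * (Q \<omega>')\<^sup>2) + b ^ 3 * m))"
  proof (rule E_mono)
    show "(\<lambda>\<omega>. a ^ 3 * (P \<omega> * (Q \<omega>)\<^sup>2)
        + E (\<lambda>\<omega>'. P \<omega> * (a * b\<^sup>2 * (Q \<omega>')\<^sup>2) + b ^ 3 * (P \<omega>' * (Q \<omega>')\<^sup>2))) \<in> H"
      by (intro add_mem E_affine_mem mems)
    show "(\<lambda>\<omega>. a ^ 3 * (P \<omega> * (Q \<omega>)\<^sup>2) + (a * b\<^sup>2 * E (\<lambda>\<omega>'. P \<omega> * (Q \<omega>')\<^sup>2) + b ^ 3 * m)) \<in> H"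
      using E_affine_mem[of P "\<lambda>\<omega>. (Q \<omega>)\<^sup>2" "\<lambda>\<omega>. 0"] by (intro mems) (simp add: mems)
    fix \<omega>
    have "E (\<lambda>\<omega>'. P \<omega> * (a * b\<^sup>2 * (Q \<omega>')\<^sup>2) + b ^ 3 * (P \<omega>' * (Q \<omega>')\<^sup>2))
        \<le> E (\<lambda>\<omega>'. P \<omega> * (a * b\<^sup>2 * (Q \<omega>')\<^sup>2)) + E (\<lambda>\<omega>'. b ^ 3 * (P \<omega>' * (Q \<omega>')\<^sup>2))"
      by (intro E_subadd mems)
    also have "E (\<lambda>\<omega>'. P \<omega> * (a * b\<^sup>2 * (Q \<omega>')\<^sup>2)) = E (\<lambda>\<omega>'. (a * b\<^sup>2) * (P \<omega> * (Q \<omega>')\<^sup>2))"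
      by (simp add: mult_ac)
    also have "\<dots> = a * b\<^sup>2 * E (\<lambda>\<omega>'. P \<omega> * (Q \<omega>')\<^sup>2)"
      using ab by (intro E_pos_hom mems) auto
    also have "E (\<lambda>\<omega>'. b ^ 3 * (P \<omega>' * (Q \<omega>')\<^sup>2)) = b ^ 3 * m"
      using ab by (intro m_scale) auto
    finally show "a ^ 3 * (P \<omega> * (Q \<omega>)\<^sup>2)
        + E (\<lambda>\<omega>'. P \<omega> * (a * b\<^sup>2 * (Q \<omega>')\<^sup>2) + b ^ 3 * (P \<omega>' * (Q \<omega>')\<^sup>2))
        \<le> a ^ 3 * (P \<omega> * (Q \<omega>)\<^sup>2) + (a * b\<^sup>2 * E (\<lambda>\<omega>'. P \<omega> * (Q \<omega>')\<^sup>2) + b ^ 3 * m)"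
      by simp
  qed
  also have "\<dots> \<le> a ^ 3 * m + (a * b\<^sup>2 * E (\<lambda>\<omega>. E (\<lambda>\<omega>'. P \<omega> * (Q \<omega>')\<^sup>2)) + b ^ 3 * m)"
  proof -
    have g: "(\<lambda>\<omega>. E (\<lambda>\<omega>'. P \<omega> * (Q \<omega>')\<^sup>2)) \<in> H"
      using E_affine_mem[of P "\<lambda>\<omega>. (Q \<omega>)\<^sup>2" "\<lambda>\<omega>. 0"] by (simp add: mems)
    have "E (\<lambda>\<omega>. a ^ 3 * (P \<omega> * (Q \<omega>)\<^sup>2) + (a * b\<^sup>2 * E (\<lambda>\<omega>'. P \<omega> * (Q \<omega>')\<^sup>2) + b ^ 3 * m))
        \<le> E (\<lambda>\<omega>. a ^ 3 * (P \<omega> * (Q \<omega>)\<^sup>2))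
          + E (\<lambda>\<omega>. a * b\<^sup>2 * E (\<lambda>\<omega>'. P \<omega> * (Q \<omega>')\<^sup>2) + b ^ 3 * m)"
      by (intro E_subadd mems g)
    moreover have "E (\<lambda>\<omega>. a * b\<^sup>2 * E (\<lambda>\<omega>'. P \<omega> * (Q \<omega>')\<^sup>2) + b ^ 3 * m)
        \<le> E (\<lambda>\<omega>. a * b\<^sup>2 * E (\<lambda>\<omega>'. P \<omega> * (Q \<omega>')\<^sup>2)) + E (\<lambda>\<omega>. b ^ 3 * m)"
      by (intro E_subadd mems g)
    moreover have "E (\<lambda>\<omega>. a * b\<^sup>2 * E (\<lambda>\<omega>'. P \<omega> * (Q \<omega>')\<^sup>2))
        = a * b\<^sup>2 * E (\<lambda>\<omega>. E (\<lambda>\<omega>'. P \<omega> * (Q \<omega>')\<^sup>2))"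
      using ab by (intro E_pos_hom g) auto
    moreover have "E (\<lambda>\<omega>. a ^ 3 * (P \<omega> * (Q \<omega>)\<^sup>2)) = a ^ 3 * m"
      using ab by (intro m_scale) auto
    ultimately show ?thesis by (simp add: E_const)
  qed
  finally show ?thesis by (simp add: r_def m_def)
qed

theorem G_normal_independent_imp_certain_variance:
  fixes X :: "'w \<Rightarrow> 'a::euclidean_space"
  assumes G: "G_normal H E X"
    and indep: "independent_from E (\<lambda>\<omega>. X \<omega> \<bullet> v) (\<lambda>\<omega>. X \<omega> \<bullet> u)"
    and nondegenerate: "E (\<lambda>\<omega>. (X \<omega> \<bullet> u)\<^sup>2) > 0"
  shows "E (\<lambda>\<omega>. (X \<omega> \<bullet> v)\<^sup>2) \<le> - E (\<lambda>\<omega>. - (X \<omega> \<bullet> v)\<^sup>2)"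
proof (rule ccontr)
  define P where "P = (\<lambda>\<omega>. X \<omega> \<bullet> u)"
  define Q where "Q = (\<lambda>\<omega>. X \<omega> \<bullet> v)"
  define m where "m = E (\<lambda>\<omega>. P \<omega> * (Q \<omega>)\<^sup>2)"
  have indep: "independent_from E Q P"
    using indep by (simp add: P_def Q_def)
  have P: "mean_zero P" and Q: "mean_zero Q"
    unfolding P_def Q_def by (intro G_normal_inner_mean_zero G)+
  then have mem: "P \<in> H" "Q \<in> H" by (simp_all add: mean_zero_def)
  have "(\<lambda>p. fst p * (snd p * snd p)) \<in> (C_lLip :: (real \<times> real \<Rightarrow> real) set)"
    by (intro C_lLip_mult C_lLip_bounded_linear bounded_linear_fst bounded_linear_snd)
  then have m: "m = E (\<lambda>\<omega>. E (\<lambda>\<omega>'. P \<omega> * (Q \<omega>')\<^sup>2))"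
    using indep unfolding independent_from_def m_def power2_eq_square by fastforce
  assume "\<not> ?thesis"
  then have "m > 0"
    unfolding m using nondegenerate by (intro mixed_third_moment_pos P mem) (simp_all add: P_def Q_def)
  have "mean_zero (\<lambda>\<omega>. P \<omega> * Q \<omega>)"
    by (intro independent_imp_mult_mean_zero indep mem Q)
  \<comment> \<open>A Pythagorean triple 12, 5, 13 in which \<open>b / a\<close> is small enough: the ratio 3 / 4 is not.\<close>
  then have "sqrt (12\<^sup>2 + 5\<^sup>2) ^ 3 * m \<le> 12 ^ 3 * m + 12 * 5\<^sup>2 * m + 5 ^ 3 * m"
    using G_normal_cubic_le[OF G, of u v 12 5] m by (simp add: P_def Q_def m_def)
  moreover have "sqrt (12\<^sup>2 + 5\<^sup>2) = (13::real)"
    by (rule real_sqrt_unique) auto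
  ultimately show False using \<open>m > 0\<close> by simp
qed

end

section \<open>The covariance set of diagonal matrices\<close>

lemma normal_zero_diag_second_moment:
  fixes X :: "'w \<Rightarrow> real ^ 2" and v :: "real ^ 2"
  assumes X: "normal_zero H E {diag2 r s | r s. r \<in> {l..h} \<and> s \<in> {l..h}} X" and "l \<le> h"
  shows "E (\<lambda>\<omega>. (X \<omega> \<bullet> v)\<^sup>2) = h * (norm v)\<^sup>2" (is ?upper)
    and "E (\<lambda>\<omega>. - (X \<omega> \<bullet> v)\<^sup>2) = - (l * (norm v)\<^sup>2)" (is ?lower)
proof -
  let ?\<Gamma> = "{diag2 r s | r s. r \<in> {l..h} \<and> s \<in> {l..h}}"
  have E: "E (\<lambda>\<omega>. c * (X \<omega> \<bullet> v)\<^sup>2) = (SUP B\<in>?\<Gamma>. c * (B $ 1 $ 1 * (v $ 1)\<^sup>2 + B $ 2 $ 2 * (v $ 2)\<^sup>2))"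
    for c
  proof -
    define A :: "real ^ 2 ^ 2" where "A = (\<chi> i j. c * (v $ i * v $ j))"
    have "transpose A = A"
      by (simp add: A_def transpose_def vec_eq_iff mult_ac)
    then have "E (\<lambda>\<omega>. (A *v X \<omega>) \<bullet> X \<omega>) = (SUP B\<in>?\<Gamma>. trace (A ** B))"
      using X by (simp add: normal_zero_def)
    moreover have "(A *v x) \<bullet> x = c * (x \<bullet> v)\<^sup>2" for x
      by (simp add: A_def inner_vec_def matrix_vector_mult_def sum_2 power2_eq_square algebra_simps)
    moreover have "trace (A ** B) = c * (B $ 1 $ 1 * (v $ 1)\<^sup>2 + B $ 2 $ 2 * (v $ 2)\<^sup>2)" if "B \<in> ?\<Gamma>" for B
      using that by (auto simp: A_def diag2_def trace_def matrix_matrix_mult_def sum_2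
          power2_eq_square algebra_simps)
    ultimately show ?thesis by simp
  qed
  have norm: "(norm v)\<^sup>2 = (v $ 1)\<^sup>2 + (v $ 2)\<^sup>2"
    unfolding power2_norm_eq_inner by (simp add: inner_vec_def sum_2 power2_eq_square)
  have mem: "diag2 l l \<in> ?\<Gamma>" "diag2 h h \<in> ?\<Gamma>" using \<open>l \<le> h\<close> by auto
  have le: "B $ 1 $ 1 * (v $ 1)\<^sup>2 + B $ 2 $ 2 * (v $ 2)\<^sup>2 \<le> h * (norm v)\<^sup>2"
    and ge: "l * (norm v)\<^sup>2 \<le> B $ 1 $ 1 * (v $ 1)\<^sup>2 + B $ 2 $ 2 * (v $ 2)\<^sup>2" if "B \<in> ?\<Gamma>" for B
    using that by (auto simp: diag2_def norm distrib_left intro!: add_mono mult_right_mono)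
  have "h * (norm v)\<^sup>2 \<in> (\<lambda>B. 1 * (B $ 1 $ 1 * (v $ 1)\<^sup>2 + B $ 2 $ 2 * (v $ 2)\<^sup>2)) ` ?\<Gamma>"
    by (rule image_eqI[OF _ mem(2)]) (simp add: diag2_def norm distrib_left)
  then have "(SUP B\<in>?\<Gamma>. 1 * (B $ 1 $ 1 * (v $ 1)\<^sup>2 + B $ 2 $ 2 * (v $ 2)\<^sup>2)) = h * (norm v)\<^sup>2"
    by (rule cSup_eq_maximum) (elim imageE, frule le, simp)
  then show ?upper using E[of 1] by simp
  have "- (l * (norm v)\<^sup>2) \<in> (\<lambda>B. (-1) * (B $ 1 $ 1 * (v $ 1)\<^sup>2 + B $ 2 $ 2 * (v $ 2)\<^sup>2)) ` ?\<Gamma>"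
    by (rule image_eqI[OF _ mem(1)]) (simp add: diag2_def norm distrib_left)
  then have "(SUP B\<in>?\<Gamma>. (-1) * (B $ 1 $ 1 * (v $ 1)\<^sup>2 + B $ 2 $ 2 * (v $ 2)\<^sup>2)) = - (l * (norm v)\<^sup>2)"
    by (rule cSup_eq_maximum) (elim imageE, frule ge, simp)
  then show ?lower using E[of "-1"] by simp
qed

theorem theorem4p6:
  fixes H :: "('w \<Rightarrow> real) set" and E :: "('w \<Rightarrow> real) \<Rightarrow> real"
    and X :: "'w \<Rightarrow> real ^ 2" and \<sigma>l \<sigma>u :: real
  assumes "sublinear_expectation_space H E"
    and "0 < \<sigma>l\<^sup>2" and "\<sigma>l\<^sup>2 < \<sigma>u\<^sup>2"
    and "random_vector H X"
    and "normal_zero H E {diag2 r1 r2 | r1 r2. r1 \<in> {\<sigma>l\<^sup>2..\<sigma>u\<^sup>2} \<and> r2 \<in> {\<sigma>l\<^sup>2..\<sigma>u\<^sup>2}} X"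
  shows "\<not> (\<exists>A :: real ^ 2 ^ 2. invertible A \<and>
    (let W1 = (\<lambda>\<omega>. (A *v X \<omega>) $ 1); W2 = (\<lambda>\<omega>. (A *v X \<omega>) $ 2)
     in independent_from E W2 W1 \<or> independent_from E W1 W2))"
proof
  interpret sublinear_expectation_space H E by fact
  have G: "G_normal H E X" using assms(5) by (simp add: normal_zero_def)
  note moment = normal_zero_diag_second_moment[OF assms(5)]
  have not_indep: "\<not> independent_from E (\<lambda>\<omega>. X \<omega> \<bullet> v) (\<lambda>\<omega>. X \<omega> \<bullet> u)" if "u \<noteq> 0" "v \<noteq> 0" for u v
  proof
    assume "independent_from E (\<lambda>\<omega>. X \<omega> \<bullet> v) (\<lambda>\<omega>. X \<omega> \<bullet> u)"
    moreover have "0 < \<sigma>u\<^sup>2 * (norm u)\<^sup>2"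
      using assms(2,3) \<open>u \<noteq> 0\<close> by (intro mult_pos_pos) (auto intro: less_trans)
    ultimately have "\<sigma>u\<^sup>2 * (norm v)\<^sup>2 \<le> \<sigma>l\<^sup>2 * (norm v)\<^sup>2"
      using G_normal_independent_imp_certain_variance[OF G, of v u] assms(3)
      by (simp add: moment)
    then show False using assms(3) \<open>v \<noteq> 0\<close> by simp
  qed
  assume "\<exists>A :: real ^ 2 ^ 2. invertible A \<and>
    (let W1 = (\<lambda>\<omega>. (A *v X \<omega>) $ 1); W2 = (\<lambda>\<omega>. (A *v X \<omega>) $ 2)
     in independent_from E W2 W1 \<or> independent_from E W1 W2)"
  then obtain A :: "real ^ 2 ^ 2" where "invertible A" and
    indep: "independent_from E (\<lambda>\<omega>. (A *v X \<omega>) $ 2) (\<lambda>\<omega>. (A *v X \<omega>) $ 1)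
      \<or> independent_from E (\<lambda>\<omega>. (A *v X \<omega>) $ 1) (\<lambda>\<omega>. (A *v X \<omega>) $ 2)"
    by (auto simp: Let_def)
  have "A $ i \<noteq> 0" for i
  proof
    assume "A $ i = 0"
    then have "det A = 0" by (intro det_zero_row) (simp add: row_def vec_eq_iff)
    then show False using \<open>invertible A\<close> by (simp add: invertible_det_nz)
  qed
  moreover have "(A *v x) $ i = x \<bullet> A $ i" for x i
    by (simp add: matrix_vector_mul_component inner_commute)
  ultimately show False using indep not_indep by auto
qed

end
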